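(* For $j\in\mathbb{Z}$ let $S_j(z,u)=\sum_{B} z^{|B|}u^{N_j(B)}$, the sum over all naturally embedded ternary trees $B$, where $|B|$ is the number of internal nodes and $N_j(B)$ the number of internal nodes with label $j$. Let $T(z)$ satisfy $T=1+zT^3$, $T(0)=1$, and let $X(z)$ be the formal power series with $X(0)=0$ and $X=z\frac{(1+X+X^2)^3}{(1+X^2)^2}$. Let $\mu=\mu(z,u)$ be the unique formal power series with $\mu(z,1)=0$ satisfying $$\mu=(u-1)\frac{(1+\mu X)(1+\mu X^2)^2(1+\mu X^5)}{(1+X)^2(1-X)^3(1-\mu^2X^5)}.$$ Then for $j\ge 0$, $$S_j(z,u)=T(z)\frac{(1+\mu X^{j+1})(1+\mu X^{j+4})}{(1+\mu X^{j+2})(1+\mu X^{j+3})}.$$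
   Context: A ternary tree is either an external node or an internal node with three ordered subtrees (left, center, right). In the natural embedding the root has label $0$ and the left, center, right children of a node with label $j$ have labels $j-1,j,j+1$. Note $S_j=S_{-j}$ by symmetry. *)

theory Defs
  imports "HOL-Computational_Algebra.Computational_Algebra"
begin

datatype ternary_tree =
    External
  | Internal (left: ternary_tree) (center: ternary_tree) (right: ternary_tree)

fun internal_nodes :: "ternary_tree \<Rightarrow> nat" where
  "internal_nodes External = 0"
| "internal_nodes (Internal l c r) = 1 + internal_nodes l + internal_nodes c + internal_nodes r"

text \<open>The number of internal nodes with label \<open>j\<close> when the root carries the label \<open>i\<close>.\<close>

fun label_count_from :: "int \<Rightarrow> int \<Rightarrow> ternary_tree \<Rightarrow> nat" where
  "label_count_from i j External = 0"
| "label_count_from i j (Internal l c r) =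
     (if i = j then 1 else 0)
     + label_count_from (i - 1) j l + label_count_from i j c + label_count_from (i + 1) j r"

definition label_count :: "int \<Rightarrow> ternary_tree \<Rightarrow> nat" where
  "label_count j B = label_count_from 0 j B"

text \<open>
  Bivariate series live in \<open>\<rat>[u][[z]]\<close>: the variable of the power series is \<open>z\<close>,
  that of the coefficient polynomials is \<open>u\<close>.
\<close>

type_synonym zu_series = "rat poly fps"

definition var_u :: zu_series where
  "var_u = fps_const [:0, 1:]"

text \<open>The inclusion of \<open>\<rat>[[z]]\<close> into \<open>\<rat>[u][[z]]\<close>.\<close>

definition of_z_series :: "rat fps \<Rightarrow> zu_series" where
  "of_z_series f = Abs_fps (\<lambda>n. [:f $ n:])"

text \<open>The specialisation \<open>u = a\<close>.\<close>

definition subst_u :: "rat \<Rightarrow> zu_series \<Rightarrow> rat fps" where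
  "subst_u a f = Abs_fps (\<lambda>n. poly (f $ n) a)"

text \<open>
  The library's division of power series needs coefficients with an inverse operation, which
  polynomials lack. The following quotient is meaningful for denominators with constant
  coefficient \<open>1\<close>; these are units, and no other denominators are used.
\<close>

definition fps_quot :: "'a::comm_ring_1 fps \<Rightarrow> 'a fps \<Rightarrow> 'a fps" (infixl \<open>\<oslash>\<close> 70) where
  "f \<oslash> g = f * fps_right_inverse g 1"

lemma fps_quot_mult_cancel:
  fixes f g :: "'a::comm_ring_1 fps"
  assumes "g $ 0 = 1"
  shows "(f \<oslash> g) * g = f"
proof -
  have "g * fps_right_inverse g 1 = 1"
    using assms by (intro fps_right_inverse) simp
  then show ?thesis
    unfolding fps_quot_def by (metis mult.assoc mult.commute mult.right_neutral)
qed

lemma fps_quot_eq_iff: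
  fixes f g h :: "'a::comm_ring_1 fps"
  assumes "g $ 0 = 1"
  shows "h = f \<oslash> g \<longleftrightarrow> h * g = f"
proof
  assume "h * g = f"
  moreover have "g * fps_right_inverse g 1 = 1"
    using assms by (intro fps_right_inverse) simp
  ultimately show "h = f \<oslash> g"
    unfolding fps_quot_def by (metis mult.assoc mult.right_neutral)
qed (simp add: fps_quot_mult_cancel assms)

text \<open>
  \<open>S\<^sub>j(z,u)\<close>, grouped by the number of internal nodes; each inner sum is finite by the lemma below.
\<close>

definition S :: "int \<Rightarrow> zu_series" where
  "S j = Abs_fps (\<lambda>n. \<Sum>B | internal_nodes B = n. monom 1 (label_count j B))"

lemma finite_internal_nodes: "finite {B. internal_nodes B = n}"
proof -
  have "finite {B. internal_nodes B \<le> n}"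
  proof (induction n)
    case 0
    have "{B. internal_nodes B \<le> 0} \<subseteq> {External}"
    proof
      fix B assume "B \<in> {B. internal_nodes B \<le> 0}"
      then show "B \<in> {External}" by (cases B) auto
    qed
    then show ?case by (rule finite_subset) simp
  next
    case (Suc n)
    let ?A = "{B. internal_nodes B \<le> n}"
    have "{B. internal_nodes B \<le> Suc n}
        \<subseteq> insert External ((\<lambda>(l, c, r). Internal l c r) ` (?A \<times> ?A \<times> ?A))"
    proof
      fix B assume "B \<in> {B. internal_nodes B \<le> Suc n}"
      then show "B \<in> insert External ((\<lambda>(l, c, r). Internal l c r) ` (?A \<times> ?A \<times> ?A))"
        by (cases B) (auto simp: image_iff)
    qed
    then show ?case by (rule finite_subset) (use Suc in simp)
  qed
  then show ?thesis by (rule rev_finite_subset) auto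
qed

definition is_mu :: "zu_series \<Rightarrow> zu_series \<Rightarrow> bool" where
  "is_mu X \<mu> \<longleftrightarrow>
     subst_u 1 \<mu> = 0 \<and>
     \<mu> = (var_u - 1) *
         (((1 + \<mu> * X) * (1 + \<mu> * X ^ 2) ^ 2 * (1 + \<mu> * X ^ 5)) \<oslash>
          ((1 + X) ^ 2 * (1 - X) ^ 3 * (1 - \<mu> ^ 2 * X ^ 5)))"

end

theory Submission
  imports Defs
begin

text \<open>
  Splitting a tree at its root gives
  \<open>S\<^sub>j = 1 + z u\<^bsup>[j = 0]\<^esup> S\<^sub>j\<^sub>-\<^sub>1 S\<^sub>j S\<^sub>j\<^sub>+\<^sub>1\<close> for all integers \<open>j\<close>, and this system determines
  all coefficients recursively. It therefore suffices that the product formula, extended evenly to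
  negative \<open>j\<close>, solves the system. Since \<open>T = (1 + X + X\<^sup>2) / (1 + X\<^sup>2)\<close>, the equations
  with \<open>j \<noteq> 0\<close> reduce, with \<open>w = \<mu> X\<^sup>j\<close>, to a polynomial identity in \<open>w\<close> and \<open>X\<close>;
  the equation for \<open>j = 0\<close> is equivalent to the one defining \<open>\<mu>\<close>.
\<close>

section \<open>Power series agreeing to a given order\<close>

text \<open>Congruence modulo the n-th power of the variable, the relation in which all uniqueness
  arguments below are run.\<close>

definition agree_below :: "nat \<Rightarrow> 'a fps \<Rightarrow> 'a fps \<Rightarrow> bool" where
  "agree_below n f g \<longleftrightarrow> (\<forall>k<n. f $ k = g $ k)"

lemma agree_below_0 [simp]: "agree_below 0 f g"
  by (simp add: agree_below_def)

lemma agree_below_refl [simp]: "agree_below n f f"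
  by (simp add: agree_below_def)

lemma agree_below_add:
  "agree_below n f f' \<Longrightarrow> agree_below n g g' \<Longrightarrow> agree_below n (f + g) (f' + g')"
  for f :: "'a::comm_ring_1 fps"
  by (simp add: agree_below_def)

lemma agree_below_diff:
  "agree_below n f f' \<Longrightarrow> agree_below n g g' \<Longrightarrow> agree_below n (f - g) (f' - g')"
  for f :: "'a::comm_ring_1 fps"
  by (simp add: agree_below_def)

lemma agree_below_mult:
  "agree_below n f f' \<Longrightarrow> agree_below n g g' \<Longrightarrow> agree_below n (f * g) (f' * g')"
  for f :: "'a::comm_ring_1 fps"
  by (auto simp: agree_below_def fps_mult_nth intro!: sum.cong)

lemma agree_below_power:
  "agree_below n f f' \<Longrightarrow> agree_below n (f ^ k) (f' ^ k)"
  for f :: "'a::comm_ring_1 fps"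
  by (induction k) (auto intro: agree_below_mult)

text \<open>A factor without constant term gains one order: coefficient \<open>k\<close> of the
  product reads \<open>f\<close> only below \<open>k\<close>. This gain is what makes the later
  recursions contracting.\<close>

lemma agree_below_mult_Suc:
  fixes f :: "'a::comm_ring_1 fps"
  assumes "agree_below n f f'" and "h $ 0 = 0"
  shows "agree_below (Suc n) (h * f) (h * f')"
  unfolding agree_below_def
proof (intro allI impI)
  fix k assume k: "k < Suc n"
  have "h $ i * f $ (k - i) = h $ i * f' $ (k - i)" if "i \<in> {0..k}" for i
  proof (cases "i = 0")
    case True
    then show ?thesis using assms(2) by simp
  next
    case False
    then have "k - i < n" using that k by auto
    then show ?thesis using assms(1) by (simp add: agree_below_def)
  qed
  then show "(h * f) $ k = (h * f') $ k"
    by (simp add: fps_mult_nth)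
qed

lemma agree_below_quot:
  fixes f :: "'a::comm_ring_1 fps"
  assumes "agree_below n f f'" "agree_below n g g'" "g $ 0 = 1" "g' $ 0 = 1"
  shows "agree_below n (f \<oslash> g) (f' \<oslash> g')"
proof -
  define r where "r = fps_right_inverse g 1"
  define r' where "r' = fps_right_inverse g' 1"
  have "g * r = 1" "g' * r' = 1"
    unfolding r_def r'_def using assms by (auto intro: fps_right_inverse)
  \<comment> \<open>Writing both inverses as multiples of the common factor \<open>r * r'\<close>
    reduces their agreement to that of \<open>g\<close> and \<open>g'\<close>.\<close>
  then have "g' * (r * r') = r" "g * (r * r') = r'"
    by (metis mult.left_commute mult.right_neutral, metis mult.assoc mult.left_neutral)
  moreover have "agree_below n (g' * (r * r')) (g * (r * r'))"
    using assms(2) by (intro agree_below_mult) (auto simp: agree_below_def)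
  ultimately have "agree_below n r r'" by simp
  then show ?thesis
    unfolding fps_quot_def r_def r'_def using assms(1) by (intro agree_below_mult)
qed

lemma fps_eqI_agree_below:
  assumes "\<And>n. agree_below n f g"
  shows "f = g"
proof (rule fps_ext)
  fix n
  show "f $ n = g $ n" using assms[of "Suc n"] by (simp add: agree_below_def)
qed

text \<open>Banach's fixed point argument in the adic metric: iteration from 0 stabilises
  coefficient by coefficient.\<close>

theorem contraction_unique_fixpoint:
  fixes \<Phi> :: "'a::comm_ring_1 fps \<Rightarrow> 'a fps"
  assumes contr: "\<And>n f g. agree_below n f g \<Longrightarrow> agree_below (Suc n) (\<Phi> f) (\<Phi> g)"
  shows "\<exists>!f. f = \<Phi> f"
proof
  \<comment> \<open>Agreement below \<open>Suc n\<close> is what settles coefficient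
    \<open>n\<close>, hence \<open>Suc n\<close> iterations.\<close>
  define h where "h = Abs_fps (\<lambda>n. (\<Phi> ^^ Suc n) 0 $ n)"
  have iter: "agree_below m ((\<Phi> ^^ m) 0) ((\<Phi> ^^ (m + d)) 0)" for m d
    by (induction m) (auto intro: contr)
  have h: "agree_below m h ((\<Phi> ^^ m) 0)" for m
    unfolding agree_below_def
  proof (intro allI impI)
    fix k assume "k < m"
    then obtain d where "m = Suc k + d"
      by (metis Suc_leI le_iff_add)
    then show "h $ k = (\<Phi> ^^ m) 0 $ k"
      using iter[of "Suc k" d] by (simp add: agree_below_def h_def)
  qed
  have "agree_below n h (\<Phi> h)" for n
    using h[of "Suc n"] contr[OF h[of n]] by (simp add: agree_below_def)
  then show "h = \<Phi> h" by (rule fps_eqI_agree_below)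
  fix f assume f: "f = \<Phi> f"
  have "agree_below n f h" for n
  proof (induction n)
    case (Suc n)
    then show ?case using contr f \<open>h = \<Phi> h\<close> by metis
  qed simp
  then show "f = h" by (rule fps_eqI_agree_below)
qed

section \<open>The recursive system for the generating functions\<close>

text \<open>Allowing any class with size and weight lets products be formed again on pairs; two such
  products handle the three subtrees. Over an infinite fibre the sum would default to 0, whence the
  finiteness assumptions below.\<close>

definition gen_fun :: "('b \<Rightarrow> nat) \<Rightarrow> ('b \<Rightarrow> 'a::comm_ring_1) \<Rightarrow> 'a fps" where
  "gen_fun s w = Abs_fps (\<lambda>n. \<Sum>x | s x = n. w x)"

lemma finite_size_pair:
  fixes s :: "'b \<Rightarrow> nat" and t :: "'c \<Rightarrow> nat"
  assumes "\<And>n. finite {x. s x = n}" and "\<And>n. finite {y. t y = n}"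
  shows "finite {p. s (fst p) + t (snd p) = n}"
proof -
  have "{p. s (fst p) + t (snd p) = n} = (\<Union>i\<in>{0..n}. {x. s x = i} \<times> {y. t y = n - i})"
    by auto
  then show ?thesis using assms by auto
qed

lemma gen_fun_mult:
  fixes s :: "'b \<Rightarrow> nat" and t :: "'c \<Rightarrow> nat"
  assumes "\<And>n. finite {x. s x = n}" and "\<And>n. finite {y. t y = n}"
  shows "gen_fun s w * gen_fun t v
       = gen_fun (\<lambda>p. s (fst p) + t (snd p)) (\<lambda>p. w (fst p) * v (snd p))"
proof (rule fps_ext)
  fix n
  have split: "{p. s (fst p) + t (snd p) = n} = (\<Union>i\<in>{0..n}. {x. s x = i} \<times> {y. t y = n - i})"
    by auto
  have "(\<Sum>p | s (fst p) + t (snd p) = n. w (fst p) * v (snd p))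
      = (\<Sum>i=0..n. \<Sum>p\<in>{x. s x = i} \<times> {y. t y = n - i}. w (fst p) * v (snd p))"
    unfolding split by (rule sum.UNION_disjoint) (use assms in auto)
  also have "\<dots> = (\<Sum>i=0..n. (\<Sum>x | s x = i. w x) * (\<Sum>y | t y = n - i. v y))"
    by (simp add: sum_product sum.cartesian_product case_prod_beta)
  finally show "(gen_fun s w * gen_fun t v) $ n
      = gen_fun (\<lambda>p. s (fst p) + t (snd p)) (\<lambda>p. w (fst p) * v (snd p)) $ n"
    by (simp add: gen_fun_def fps_mult_nth)
qed

lemma label_count_from_shift: "label_count_from i j B = label_count (j - i) B"
proof -
  have "label_count_from i j B = label_count_from (i + d) (j + d) B" for d
  proof (induction B arbitrary: i)
    case (Internal l c r)
    from Internal(1)[of "i - 1"] Internal(2)[of i] Internal(3)[of "i + 1"]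
    show ?case by (simp add: algebra_simps)
  qed simp
  from this[of "- i"] show ?thesis by (simp add: label_count_def)
qed

text \<open>The left subtree has root label -1, so relative to its own root the label
  \<open>j\<close> is \<open>j + 1\<close>; on the right it is \<open>j - 1\<close>.\<close>

lemma label_count_Internal:
  "label_count j (Internal l c r) = (if j = 0 then 1 else 0)
     + label_count (j + 1) l + label_count j c + label_count (j - 1) r"
proof -
  have "label_count j (Internal l c r) = (if j = 0 then 1 else 0)
      + label_count_from (-1) j l + label_count_from 0 j c + label_count_from 1 j r"
    by (simp add: label_count_def)
  then show ?thesis
    by (simp add: label_count_from_shift)
qed

lemma S_rec:
  "S j = 1 + fps_X * ((if j = 0 then var_u else 1) * (S (j - 1) * S j * S (j + 1)))"
proof (rule fps_ext)
  fix n
  let ?c = "if j = 0 then var_u else 1 :: zu_series"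
  let ?w = "\<lambda>j B. monom (1::rat) (label_count j B)"
  let ?s = "\<lambda>p. internal_nodes (fst p) + internal_nodes (snd p)"
  have S: "S i = gen_fun internal_nodes (?w i)" for i
    by (simp add: S_def gen_fun_def)
  have prod: "S (j + 1) * S j * S (j - 1) = gen_fun (\<lambda>p. ?s (fst p) + internal_nodes (snd p))
      (\<lambda>p. ?w (j + 1) (fst (fst p)) * ?w j (snd (fst p)) * ?w (j - 1) (snd p))"
    by (simp add: S gen_fun_mult finite_internal_nodes finite_size_pair)
  show "S j $ n = (1 + fps_X * (?c * (S (j - 1) * S j * S (j + 1)))) $ n"
  proof (cases n)
    case 0
    have "{B. internal_nodes B = 0} = {External}"
    proof (intro set_eqI)
      fix B show "B \<in> {B. internal_nodes B = 0} \<longleftrightarrow> B \<in> {External}" by (cases B) auto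
    qed
    then show ?thesis using 0 by (simp add: S_def label_count_def)
  next
    case (Suc m)
    \<comment> \<open>A triple of subtrees is encoded as a nested pair, matching the product of
      three generating functions.\<close>
    let ?N = "\<lambda>p. Internal (fst (fst p)) (snd (fst p)) (snd p)"
    let ?k = "if j = 0 then 1 else 0 :: nat"
    have trees: "{B. internal_nodes B = Suc m} = ?N ` {p. ?s (fst p) + internal_nodes (snd p) = m}"
    proof (intro set_eqI)
      fix B
      show "B \<in> {B. internal_nodes B = Suc m}
          \<longleftrightarrow> B \<in> ?N ` {p. ?s (fst p) + internal_nodes (snd p) = m}"
        by (cases B) (auto simp: image_iff)
    qed
    have "S j $ Suc m = (\<Sum>p | ?s (fst p) + internal_nodes (snd p) = m. ?w j (?N p))"
      unfolding S_def fps_nth_Abs_fps trees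
      by (subst sum.reindex) (auto simp: inj_on_def prod_eq_iff)
    also have "\<dots> = monom 1 ?k * (\<Sum>p | ?s (fst p) + internal_nodes (snd p) = m.
        ?w (j + 1) (fst (fst p)) * ?w j (snd (fst p)) * ?w (j - 1) (snd p))"
      by (simp add: sum_distrib_left label_count_Internal mult_monom add.assoc)
    also have "\<dots> = (fps_const (monom 1 ?k) * (S (j + 1) * S j * S (j - 1))) $ m"
      by (simp add: prod gen_fun_def)
    also have "fps_const (monom 1 ?k) = ?c"
      by (simp add: var_u_def monom_altdef monom_Suc)
    also have "S (j + 1) * S j * S (j - 1) = S (j - 1) * S j * S (j + 1)"
      by (simp add: ac_simps)
    finally show ?thesis using Suc by (simp add: fps_X_mult_nth)
  qed
qed

text \<open>The factor \<open>fps_X\<close> makes coefficient \<open>n\<close> depend only on lower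
  coefficients at \<open>j\<close> and its two neighbours, so the induction on the order treats all
  \<open>j\<close> at once.\<close>

lemma cubic_system_unique:
  fixes F G c :: "int \<Rightarrow> 'a::comm_ring_1 fps"
  assumes "\<And>j. F j = 1 + fps_X * (c j * (F (j - 1) * F j * F (j + 1)))"
    and "\<And>j. G j = 1 + fps_X * (c j * (G (j - 1) * G j * G (j + 1)))"
  shows "F = G"
proof
  fix j
  have "agree_below n (F j) (G j)" for n
  proof (induction n arbitrary: j)
    case (Suc n)
    show ?case
      by (subst assms(1), subst assms(2))
        (intro agree_below_add agree_below_mult_Suc agree_below_mult Suc; simp)
  qed simp
  then show "F j = G j" by (rule fps_eqI_agree_below)
qed

section \<open>The series \<open>\<mu>\<close> and the product formula\<close>

text \<open>This and the next lemmas make the inclusion a ring homomorphism, so that identities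
  proved over the field of rationals transfer to polynomial coefficients.\<close>

lemma of_z_series_1 [simp]: "of_z_series 1 = 1"
  by (rule fps_ext) (simp add: of_z_series_def one_pCons)

lemma of_z_series_X [simp]: "of_z_series fps_X = fps_X"
  by (rule fps_ext) (simp add: of_z_series_def one_pCons)

lemma of_z_series_add [simp]: "of_z_series (f + g) = of_z_series f + of_z_series g"
  by (rule fps_ext) (simp add: of_z_series_def)

lemma of_z_series_mult [simp]: "of_z_series (f * g) = of_z_series f * of_z_series g"
proof (rule fps_ext)
  fix n
  have "[:sum h A:] = (\<Sum>i\<in>A. [:h i:])" for h :: "nat \<Rightarrow> rat" and A
    by (rule poly_eqI) (simp add: coeff_sum coeff_pCons split: nat.split)
  then show "of_z_series (f * g) $ n = (of_z_series f * of_z_series g) $ n"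
    by (simp add: of_z_series_def fps_mult_nth mult.commute)
qed

lemma of_z_series_power [simp]: "of_z_series (f ^ n) = of_z_series f ^ n"
  by (induction n) auto

lemma subst_u_mult: "subst_u a (f * g) = subst_u a f * subst_u a g"
  by (rule fps_ext) (simp add: subst_u_def fps_mult_nth poly_sum)

lemma subst_u_1_var_u_minus_1: "subst_u 1 (var_u - 1) = 0"
  by (rule fps_ext) (simp add: subst_u_def var_u_def)

lemma ex1_is_mu:
  assumes "X $ 0 = 0"
  shows "\<exists>!\<mu>. is_mu X \<mu>"
proof -
  \<comment> \<open>Each occurrence of \<open>\<mu>\<close> on the right comes with a factor
    \<open>X\<close>, so the right side is a function of \<open>y = X * \<mu>\<close>. Multiplying
    by \<open>X\<close> gains the order needed for a contraction.\<close>
  define G where "G y = ((1 + y) * (1 + y * X) ^ 2 * (1 + y * X ^ 4)) \<oslash>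
    ((1 + X) ^ 2 * (1 - X) ^ 3 * (1 - y ^ 2 * X ^ 3))" for y :: zu_series
  have G: "((1 + \<mu> * X) * (1 + \<mu> * X ^ 2) ^ 2 * (1 + \<mu> * X ^ 5)) \<oslash>
      ((1 + X) ^ 2 * (1 - X) ^ 3 * (1 - \<mu> ^ 2 * X ^ 5)) = G (X * \<mu>)" for \<mu>
    by (simp add: G_def power_mult_distrib algebra_simps flip: power_Suc power_add
        add: power2_eq_square power_numeral_reduce)
  have is_mu: "is_mu X \<mu> \<longleftrightarrow> \<mu> = (var_u - 1) * G (X * \<mu>)" for \<mu>
  proof -
    \<comment> \<open>The factor \<open>var_u - 1\<close> vanishes at u = 1, so every fixed point is
      correctly normalised.\<close>
    have "subst_u 1 \<mu> = 0" if "\<mu> = (var_u - 1) * G (X * \<mu>)"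
      by (subst that) (simp add: subst_u_mult subst_u_1_var_u_minus_1)
    then show ?thesis unfolding is_mu_def G by blast
  qed
  have "agree_below (Suc n) ((var_u - 1) * G (X * f)) ((var_u - 1) * G (X * g))"
    if "agree_below n f g" for n f g
  proof -
    define y y' where "y = X * f" and "y' = X * g"
    have "y $ 0 = 0" "y' $ 0 = 0" using assms by (simp_all add: y_def y'_def)
    moreover have "agree_below (Suc n) y y'"
      unfolding y_def y'_def using that assms by (rule agree_below_mult_Suc)
    ultimately have "agree_below (Suc n) ((var_u - 1) * G y) ((var_u - 1) * G y')"
      unfolding G_def using assms
      by (intro agree_below_mult agree_below_quot agree_below_add agree_below_diff
          agree_below_power agree_below_refl) (simp_all add: fps_power_zeroth)
    then show ?thesis by (simp add: y_def y'_def)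
  qed
  then show ?thesis
    unfolding is_mu by (rule contraction_unique_fixpoint)
qed

text \<open>With \<open>E\<close> and \<open>A\<close> as below, \<open>T * E\<close> and
  \<open>A\<close> are both roots of the cubic \<open>fps_X * Y ^ 3 - E ^ 2 * Y + E ^ 3\<close>, and
  only one root can be a power series here.\<close>

lemma ternary_series_parametrization:
  fixes T X :: "'a::field fps"
  assumes T: "T = 1 + fps_X * T ^ 3"
    and X_0: "X $ 0 = 0" and X: "X = fps_X * ((1 + X + X ^ 2) ^ 3 / (1 + X ^ 2) ^ 2)"
  shows "T * (1 + X ^ 2) = 1 + X + X ^ 2"
proof -
  define E A where "E = 1 + X ^ 2" and "A = 1 + X + X ^ 2"
  have E_0: "E $ 0 = 1" using X_0 by (simp add: E_def fps_power_zeroth)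
  have "is_unit (E ^ 2)" using E_0 by (simp add: fps_is_unit_iff fps_power_zeroth)
  then have "A ^ 3 / E ^ 2 * E ^ 2 = A ^ 3"
    by (meson dvd_div_mult_self unit_imp_dvd)
  moreover have "X * E ^ 2 = fps_X * (A ^ 3 / E ^ 2 * E ^ 2)"
    using X by (metis A_def E_def mult.assoc)
  ultimately have X': "X * E ^ 2 = fps_X * A ^ 3" by simp
  have A: "A = E + X" by (simp add: A_def E_def)
  \<comment> \<open>The divided difference of the cubic at the two roots. Its constant term is -1,
    so it is nonzero and cancels.\<close>
  let ?Q = "fps_X * ((T * E) ^ 2 + T * E * A + A ^ 2) - E ^ 2"
  have "(T * E - A) * ?Q = E ^ 3 * (1 + fps_X * T ^ 3 - T) + (X * E ^ 2 - fps_X * A ^ 3) + E\<^sup>2 * (A - E - X)"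
    by (simp add: algebra_simps power2_eq_square power3_eq_cube)
  also have "\<dots> = 0" using T X' A by simp
  finally have "(T * E - A) * ?Q = 0" .
  moreover have "?Q $ 0 \<noteq> 0" using E_0 by (simp add: fps_power_zeroth)
  then have "?Q \<noteq> 0" by (metis fps_zero_nth)
  ultimately show ?thesis by (simp add: E_def A_def)
qed

text \<open>The difference of the two sides is a multiple of the assumed relation between
  \<open>t\<close> and \<open>x\<close>.\<close>

lemma product_step_identity:
  fixes t x w :: "'a::comm_ring_1"
  assumes "t * (1 + x ^ 2) = 1 + x + x ^ 2"
  shows "t * ((1 + w * x) * (1 + w * x ^ 4))
    = (1 + w * x ^ 2) * (1 + w * x ^ 3) + (t - 1) * ((1 + w) * (1 + w * x ^ 5))"
proof -
  have "t * ((1 + w * x) * (1 + w * x ^ 4))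
      - (1 + w * x ^ 2) * (1 + w * x ^ 3) - (t - 1) * ((1 + w) * (1 + w * x ^ 5))
      = - w * (1 - x) * (1 - x\<^sup>2) * (t * (1 + x ^ 2) - (1 + x + x ^ 2))"
    by (simp add: algebra_simps power_numeral_reduce)
  also have "\<dots> = 0" using assms by simp
  finally show ?thesis by (simp add: diff_diff_eq)
qed

text \<open>For \<open>a\<close>, \<open>b\<close>, \<open>c\<close> three consecutive values of the
  product formula the inner factors telescope, leaving \<open>t ^ 3 * (p0 * p5)\<close>; then
  \<open>z * t ^ 3 = t - 1\<close> turns the claim into \<open>step\<close>. Everything is
  cross-multiplied, since the coefficient ring is not a field.\<close>

lemma product_step:
  fixes a b c t z p0 p1 p2 p3 p4 p5 :: "'a::idom"
  assumes nz: "p1 \<noteq> 0" "p2 \<noteq> 0" "p3 \<noteq> 0" "p4 \<noteq> 0"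
    and a: "a * (p1 * p2) = t * (p0 * p3)"
    and b: "b * (p2 * p3) = t * (p1 * p4)"
    and c: "c * (p3 * p4) = t * (p2 * p5)"
    and t: "t = 1 + z * t ^ 3"
    and step: "t * (p1 * p4) = p2 * p3 + (t - 1) * (p0 * p5)"
  shows "b = 1 + z * (a * b * c)"
proof -
  have "(a * b * c * (p2 * p3)) * (p1 * p2 * p3 * p4)
      = (a * (p1 * p2)) * (b * (p2 * p3)) * (c * (p3 * p4))"
    by (simp add: ac_simps)
  also have "\<dots> = (t ^ 3 * (p0 * p5)) * (p1 * p2 * p3 * p4)"
    unfolding a b c by (simp add: ac_simps power3_eq_cube)
  finally have abc: "a * b * c * (p2 * p3) = t ^ 3 * (p0 * p5)"
    using nz by simp
  have "(1 + z * (a * b * c)) * (p2 * p3) = p2 * p3 + z * (a * b * c * (p2 * p3))"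
    by (simp add: algebra_simps)
  also have "\<dots> = p2 * p3 + (z * t ^ 3) * (p0 * p5)"
    unfolding abc by (simp add: ac_simps)
  also have "z * t ^ 3 = t - 1"
    using t by (simp add: algebra_simps)
  also have "p2 * p3 + (t - 1) * (p0 * p5) = b * (p2 * p3)"
    using step b by simp
  finally show ?thesis using nz by simp
qed

text \<open>At the centre both neighbours equal \<open>c\<close> by symmetry, so the product no
  longer telescopes to \<open>p0 * p5\<close>. The relation \<open>u\<close> corrects exactly this
  discrepancy.\<close>

lemma product_step_0:
  fixes b c t u z p0 p1 p2 p3 p4 p5 :: "'a::idom"
  assumes nz: "p2 \<noteq> 0" "p3 \<noteq> 0" "p4 \<noteq> 0"
    and b: "b * (p2 * p3) = t * (p1 * p4)"
    and c: "c * (p3 * p4) = t * (p2 * p5)"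
    and t: "t = 1 + z * t ^ 3"
    and step: "t * (p1 * p4) = p2 * p3 + (t - 1) * (p0 * p5)"
    and u: "p0 * p4 * p3 ^ 2 = u * (p1 * p2 ^ 2 * p5)"
  shows "b = 1 + z * (u * (c * b * c))"
proof -
  have "(c * b * c * (p3 ^ 3 * p4)) * (p2 * p4)
      = (b * (p2 * p3)) * (c * (p3 * p4)) * (c * (p3 * p4))"
    by (simp add: ac_simps power3_eq_cube)
  also have "\<dots> = (t ^ 3 * (p1 * p2 * p5 ^ 2)) * (p2 * p4)"
    unfolding b c by (simp add: ac_simps power3_eq_cube power2_eq_square)
  finally have cbc: "c * b * c * (p3 ^ 3 * p4) = t ^ 3 * (p1 * p2 * p5 ^ 2)"
    using nz by simp
  have "(1 + z * (u * (c * b * c))) * (p2 * p3 * (p3 ^ 2 * p4))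
      = p2 * p3 * (p3 ^ 2 * p4) + z * u * p2 * (c * b * c * (p3 ^ 3 * p4))"
    by (simp add: algebra_simps power3_eq_cube power2_eq_square)
  also have "\<dots> = p2 * p3 * (p3 ^ 2 * p4) + (z * t ^ 3) * (u * (p1 * p2 ^ 2 * p5)) * p5"
    unfolding cbc by (simp add: ac_simps power2_eq_square)
  also have "z * t ^ 3 = t - 1"
    using t by (simp add: algebra_simps)
  also have "p2 * p3 * (p3 ^ 2 * p4) + (t - 1) * (u * (p1 * p2 ^ 2 * p5)) * p5
      = (p2 * p3 + (t - 1) * (p0 * p5)) * (p3 ^ 2 * p4)"
    unfolding u[symmetric] by (simp add: algebra_simps)
  also have "\<dots> = b * (p2 * p3 * (p3 ^ 2 * p4))"
    unfolding step[symmetric] b[symmetric] by (simp add: ac_simps)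
  finally show ?thesis using nz by simp
qed

text \<open>Clearing denominators in the equation for \<open>\<mu>\<close> gives
  \<open>N + \<mu> * D = var_u * N\<close> for its numerator \<open>N\<close> and denominator
  \<open>D\<close>; the identity factors the left side.\<close>

lemma mu_identity:
  fixes m x :: "'a::comm_ring_1"
  shows "(1 + m) * (1 + m * x ^ 4) * (1 + m * x ^ 3) ^ 2
    = (1 + m * x) * (1 + m * x ^ 2) ^ 2 * (1 + m * x ^ 5)
      + m * ((1 + x) ^ 2 * (1 - x) ^ 3 * (1 - m ^ 2 * x ^ 5))"
proof -
  have "(1 + x) ^ 2 * (1 - x) ^ 3 = 1 - x - 2 * x ^ 2 + 2 * x ^ 3 + x ^ 4 - x ^ 5"
    by (simp add: algebra_simps power_numeral_reduce)
  then show ?thesis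
    by (simp add: algebra_simps power_numeral_reduce)
qed

lemma is_mu_cleared:
  assumes "is_mu X \<mu>" and X_0: "X $ 0 = 0"
  shows "(1 + \<mu>) * (1 + \<mu> * X ^ 4) * (1 + \<mu> * X ^ 3) ^ 2
    = var_u * ((1 + \<mu> * X) * (1 + \<mu> * X ^ 2) ^ 2 * (1 + \<mu> * X ^ 5))"
proof -
  define N D where "N = (1 + \<mu> * X) * (1 + \<mu> * X ^ 2) ^ 2 * (1 + \<mu> * X ^ 5)"
    and "D = (1 + X) ^ 2 * (1 - X) ^ 3 * (1 - \<mu> ^ 2 * X ^ 5)"
  have "D $ 0 = 1" using X_0 by (simp add: D_def fps_power_zeroth)
  then have "N \<oslash> D * D = N" by (rule fps_quot_mult_cancel)
  moreover have "\<mu> = (var_u - 1) * (N \<oslash> D)"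
    using assms(1) unfolding is_mu_def N_def D_def by (rule conjunct2)
  ultimately have "\<mu> * D = (var_u - 1) * N" by (metis mult.assoc)
  then have "N + \<mu> * D = var_u * N" by (simp add: left_diff_distrib)
  then show ?thesis unfolding mu_identity N_def D_def .
qed

theorem theorem2:
  fixes T X :: "rat fps"
  assumes T_eq: "T = 1 + fps_X * T ^ 3" and T_0: "T $ 0 = 1"
    and X_0: "X $ 0 = 0" and X_eq: "X = fps_X * ((1 + X + X ^ 2) ^ 3 / (1 + X ^ 2) ^ 2)"
  shows "(\<exists>!\<mu>. is_mu (of_z_series X) \<mu>) \<and>
    (\<forall>\<mu>. is_mu (of_z_series X) \<mu> \<longrightarrow>
      (\<forall>j::nat.
        S (int j) = of_z_series T *
          (((1 + \<mu> * of_z_series X ^ (j + 1)) * (1 + \<mu> * of_z_series X ^ (j + 4))) \<oslash>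
           ((1 + \<mu> * of_z_series X ^ (j + 2)) * (1 + \<mu> * of_z_series X ^ (j + 3))))))"
proof (intro conjI allI impI)
  define x t where "x = of_z_series X" and "t = of_z_series T"
  have x_0: "x $ 0 = 0" using X_0 by (simp add: x_def of_z_series_def)
  show "\<exists>!\<mu>. is_mu (of_z_series X) \<mu>"
    using x_0 unfolding x_def by (rule ex1_is_mu)
  fix \<mu> and j :: nat
  assume mu: "is_mu (of_z_series X) \<mu>"
  have t: "t = 1 + fps_X * t ^ 3"
    using arg_cong[OF T_eq, of of_z_series] by (simp add: t_def)
  have tx: "t * (1 + x ^ 2) = 1 + x + x ^ 2"
    using arg_cong[OF ternary_series_parametrization[OF T_eq X_0 X_eq], of of_z_series]
    by (simp add: t_def x_def)
  define P where "P k = 1 + \<mu> * x ^ k" for k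
  define f where "f n = t * ((P (n + 1) * P (n + 4)) \<oslash> (P (n + 2) * P (n + 3)))" for n
  \<comment> \<open>The case \<open>k = 0\<close> differs: \<open>P 0\<close> is
    \<open>1 + \<mu>\<close>, whose constant coefficient is u.\<close>
  have P_0: "P k $ 0 = 1" if "k > 0" for k
    using that x_0 by (simp add: P_def fps_power_zeroth)
  then have P_nz: "P k \<noteq> 0" if "k > 0" for k
    using that by (metis fps_zero_nth zero_neq_one)
  have f: "f n * (P (n + 2) * P (n + 3)) = t * (P (n + 1) * P (n + 4))" for n
    unfolding f_def by (simp add: P_0 fps_quot_mult_cancel mult.assoc)
  have step: "t * (P (n + 1) * P (n + 4)) = P (n + 2) * P (n + 3) + (t - 1) * (P n * P (n + 5))" for n
    using product_step_identity[OF tx, of "\<mu> * x ^ n"]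
    unfolding P_def power_add mult.assoc power_one_right .
  have rec_Suc: "f (Suc n) = 1 + fps_X * (f n * f (Suc n) * f (Suc (Suc n)))" for n
    by (rule product_step[OF _ _ _ _ _ _ _ t step[of "Suc n"]])
      (use f[of n] f[of "Suc n"] f[of "Suc (Suc n)"] in \<open>simp_all add: P_nz eval_nat_numeral\<close>)
  have u: "P 0 * P 4 * P 3 ^ 2 = var_u * (P 1 * P 2 ^ 2 * P 5)"
    using is_mu_cleared[OF mu[folded x_def] x_0] by (simp add: P_def)
  have rec_0: "f 0 = 1 + fps_X * (var_u * (f 1 * f 0 * f 1))"
    by (rule product_step_0[OF _ _ _ _ _ t _ u])
      (use f[of 0] f[of 1] step[of 0] in \<open>simp_all add: P_nz eval_nat_numeral\<close>)
  \<comment> \<open>The formula is extended evenly to all integers, so that the system has an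
    equation at every index.\<close>
  have "S = (\<lambda>i. f (nat \<bar>i\<bar>))"
  proof (rule cubic_system_unique[OF S_rec])
    fix i :: int
    consider "i = 0" | n where "i = int (Suc n)" | n where "i = - int (Suc n)"
      by (metis int_cases3 of_nat_0_less_iff gr0_implies_Suc)
    then show "f (nat \<bar>i\<bar>) = 1 + fps_X * ((if i = 0 then var_u else 1) *
        (f (nat \<bar>i - 1\<bar>) * f (nat \<bar>i\<bar>) * f (nat \<bar>i + 1\<bar>)))"
    proof cases
      case 1
      then show ?thesis using rec_0 by simp
    next
      case (2 n)
      then have "nat \<bar>i - 1\<bar> = n" "nat \<bar>i\<bar> = Suc n" "nat \<bar>i + 1\<bar> = Suc (Suc n)" "i \<noteq> 0"
        by auto
      then show ?thesis using rec_Suc[of n] by simp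
    next
      \<comment> \<open>On the negative side the two neighbours swap roles, and commutativity
        restores \<open>rec_Suc\<close>.\<close>
      case (3 n)
      then have "nat \<bar>i - 1\<bar> = Suc (Suc n)" "nat \<bar>i\<bar> = Suc n" "nat \<bar>i + 1\<bar> = n" "i \<noteq> 0"
        by auto
      then show ?thesis using rec_Suc[of n] by (simp add: ac_simps)
    qed
  qed
  from fun_cong[OF this, of "int j"] have "S (int j) = f j" by simp
  then show "S (int j) = of_z_series T *
      (((1 + \<mu> * of_z_series X ^ (j + 1)) * (1 + \<mu> * of_z_series X ^ (j + 4))) \<oslash>
       ((1 + \<mu> * of_z_series X ^ (j + 2)) * (1 + \<mu> * of_z_series X ^ (j + 3))))"
    unfolding f_def P_def t_def x_def .
qed

end
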